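(* Let $\mathcal{G}$ be the space of future distributions of a stationary discrete-time stochastic process with values in a countable set $\mathcal{O}$, with Hamel basis $(g_{\bar a})_{\bar a\in\Lambda}$, $\Lambda\subseteq\mathcal{O}^{*}$. For $g_1=\sum_{\bar a\in\Lambda}\alpha_{\bar a}g_{\bar a}\in\mathcal{G}$ and $g_2=\sum_{\bar b\in\Lambda}\beta_{\bar b}g_{\bar b}\in\mathcal{G}$ (finitely many nonzero real coefficients), the map $$\langle g_1,g_2\rangle:=\langle\phi(g_1),\phi(g_2)\rangle_{L^2(\mu_\epsilon)}=\int_F\Big(\sum_{\bar a\in\Lambda}\alpha_{\bar a}\gamma(g_{\bar a})\Big)\Big(\sum_{\bar b\in\Lambda}\beta_{\bar b}\gamma(g_{\bar b})\Big)\,d\mu_\epsilon$$ defines an inner product on $\mathcal{G}$.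
   Context: Let $\mathcal{O}$ be a (nonempty) countable set and let $(X_t)_{t\in\mathbb{Z}}$ be a stationary stochastic process with values in $\mathcal{O}$, i.e. $\mathbb{P}(X_{t_1}=x_1,\dots,X_{t_k}=x_k)=\mathbb{P}(X_{t_1+l}=x_1,\dots,X_{t_k+l}=x_k)$ for all times $t_1,\dots,t_k\in\mathbb{Z}$, all $x_i\in\mathcal{O}$ and all $l\in\mathbb{Z}$. Let $\mathcal{O}^{+}=\bigcup_{i\ge 1}\mathcal{O}^i$ and $\mathcal{O}^{*}=\mathcal{O}^{+}\cup\{\epsilon\}$, where $\epsilon$ is the empty string. For $\bar a=x_1\cdots x_k\in\mathcal{O}^k$ write $\mathbb{P}(\bar a)=\mathbb{P}(X_{1}=x_1,\dots,X_{k}=x_k)$, and $\mathbb{P}(\epsilon)=1$. Concatenation of strings is written $\bar a\bar b$, and $\mathbb{P}(\bar b\mid\bar a)=\mathbb{P}(\bar a\bar b)/\mathbb{P}(\bar a)$ if $\mathbb{P}(\bar a)\neq 0$. For each $\bar a\in\mathcal{O}^{*}$ define $g_{\bar a}:\mathcal{O}^{*}\to\mathbb{R}$ by $g_{\bar a}(\bar b)=\mathbb{P}(\bar b\mid\bar a)$ if $\mathbb{P}(\bar a)\neq 0$ (so $g_{\bar a}(\epsilon)=1$), and $g_{\bar a}\equiv 0$ if $\mathbb{P}(\bar a)=0$. The space of future distributions $\mathcal{G}$ is the real vector space of all finite linear combinations of the functions $g_{\bar a}$, $\bar a\in\mathcal{O}^{*}$. A set $\Lambda\subseteq\mathcal{O}^{*}$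 is fixed such that $(g_{\bar a})_{\bar a\in\Lambda}$ is a Hamel basis of $\mathcal{G}$. Let $F$ be the set of all right-infinite sequences of elements of $\mathcal{O}$; for $\bar b\in\mathcal{O}^k$, $k\ge1$, let $E(\bar b)\subseteq F$ be the set of sequences whose first $k$ symbols form $\bar b$. Let $\mathcal{E}=\bigcup_{k=1}^\infty\{\bigcup_{\bar b\in K}E(\bar b): K\subseteq\mathcal{O}^k\}$, an algebra of subsets of $F$, and let $\sigma(\mathcal{E})$ be the $\sigma$-algebra it generates. For $\bar a\in\mathcal{O}^{*}$, $\mu_{\bar a}$ is the unique finite measure on $\sigma(\mathcal{E})$ with $\mu_{\bar a}(\bigcup_{\bar b\in K}E(\bar b))=\sum_{\bar b\in K}g_{\bar a}(\bar b)$ for all $k\ge1$, $K\subseteq\mathcal{O}^k$. Each $\mu_{\bar a}$ has a density $\gamma(g_{\bar a})$ with respect to $\mu_\epsilon$ (the Radon–Nikodym derivative, unique up to $\mu_\epsilon$-null sets): $\mu_{\bar a}(A)=\int_A\gamma(g_{\bar a})\,d\mu_\epsilon$ for all $A\in\sigma(\mathcal{E})$, and its class $[\gamma(g_{\bar a})]$ modulo $\mu_\epsilon$-a.e. equality lies in the real space $L^2(\mu_\epsilon)$. The map $\phi:\mathcal{G}\to L^2(\mu_\epsilon)$ is the linear map with $\phi(g_{\bar a})=[\gamma(g_{\bar a})]$ for $\bar a\in\Lambda$. *)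

theory Defs
  imports "HOL-Probability.Probability" "HOL-Library.Function_Algebras"
begin

text \<open>The pointwise real vector space structure on functions; addition, zero and negation
  come from \<open>Function_Algebras\<close>.\<close>

instantiation "fun" :: (type, real_vector) real_vector
begin

definition scaleR_fun :: "real \<Rightarrow> ('a \<Rightarrow> 'b) \<Rightarrow> 'a \<Rightarrow> 'b" where
  "scaleR_fun c f = (\<lambda>x. c *\<^sub>R f x)"

instance
  by standard (simp_all add: scaleR_fun_def plus_fun_def scaleR_add_right scaleR_add_left)

end


definition stationary_process :: "'w measure \<Rightarrow> (int \<Rightarrow> 'w \<Rightarrow> 'o::countable) \<Rightarrow> bool" where
  "stationary_process M X \<longleftrightarrow>
     prob_space M \<and>
     (\<forall>t. X t \<in> measurable M (count_space UNIV)) \<and>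
     (\<forall>(ts :: int list) xs l. length ts = length xs \<longrightarrow>
        measure M {w \<in> space M. \<forall>i<length xs. X (ts ! i) w = xs ! i} =
        measure M {w \<in> space M. \<forall>i<length xs. X (ts ! i + l) w = xs ! i})"

text \<open>Strings over the alphabet are lists, \<open>[]\<close> being the empty string. List positions start
  at \<open>0\<close>, process times at \<open>1\<close>.\<close>

definition string_prob :: "'w measure \<Rightarrow> (int \<Rightarrow> 'w \<Rightarrow> 'o) \<Rightarrow> 'o list \<Rightarrow> real" where
  "string_prob M X a = measure M {w \<in> space M. \<forall>i<length a. X (1 + int i) w = a ! i}"

definition future_dist ::
    "'w measure \<Rightarrow> (int \<Rightarrow> 'w \<Rightarrow> 'o) \<Rightarrow> 'o list \<Rightarrow> 'o list \<Rightarrow> real" where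
  "future_dist M X a b =
     (if string_prob M X a \<noteq> 0 then string_prob M X (a @ b) / string_prob M X a else 0)"

definition future_space :: "'w measure \<Rightarrow> (int \<Rightarrow> 'w \<Rightarrow> 'o) \<Rightarrow> ('o list \<Rightarrow> real) set" where
  "future_space M X = span (range (future_dist M X))"

text \<open>Injectivity is required because it is the family indexed by \<open>\<Lambda>\<close>, not merely its range,
  that is a basis.\<close>

definition future_basis :: "'w measure \<Rightarrow> (int \<Rightarrow> 'w \<Rightarrow> 'o) \<Rightarrow> 'o list set \<Rightarrow> bool" where
  "future_basis M X \<Lambda> \<longleftrightarrow>
     inj_on (future_dist M X) \<Lambda> \<and>
     independent (future_dist M X ` \<Lambda>) \<and>
     span (future_dist M X ` \<Lambda>) = future_space M X"


definition cylinder :: "'o list \<Rightarrow> (nat \<Rightarrow> 'o) set" where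
  "cylinder b = {s. \<forall>i<length b. s i = b ! i}"

definition cylinder_algebra :: "(nat \<Rightarrow> 'o) set set" where
  "cylinder_algebra = {(\<Union>b\<in>K. cylinder b) | k K. 1 \<le> k \<and> K \<subseteq> {b. length b = k}}"

text \<open>\<open>future_measure (future_dist M X a)\<close> is the measure \<open>\<mu>\<^sub>a\<close>. The possibly infinite sum over
  \<open>K\<close> is an unconditionally convergent one.\<close>

definition future_measure :: "('o list \<Rightarrow> real) \<Rightarrow> (nat \<Rightarrow> 'o) measure" where
  "future_measure g = (THE m.
     sets m = sets (sigma UNIV cylinder_algebra) \<and>
     finite_measure m \<and>
     (\<forall>k\<ge>1. \<forall>K \<subseteq> {b. length b = k}. (g has_sum measure m (\<Union>b\<in>K. cylinder b)) K))"

definition base_measure :: "'w measure \<Rightarrow> (int \<Rightarrow> 'w \<Rightarrow> 'o) \<Rightarrow> (nat \<Rightarrow> 'o) measure" where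
  "base_measure M X = future_measure (future_dist M X [])"

definition future_density ::
    "'w measure \<Rightarrow> (int \<Rightarrow> 'w \<Rightarrow> 'o) \<Rightarrow> ('o list \<Rightarrow> real) \<Rightarrow> (nat \<Rightarrow> 'o) \<Rightarrow> real" where
  "future_density M X g = (\<lambda>s. enn2real (RN_deriv (base_measure M X) (future_measure g) s))"


text \<open>The real Hilbert space \<open>L\<^sup>2(m)\<close> as a quotient of the square-integrable functions.\<close>

definition square_integrable :: "'s measure \<Rightarrow> ('s \<Rightarrow> real) set" where
  "square_integrable m = {f \<in> borel_measurable m. integrable m (\<lambda>s. (f s)\<^sup>2)}"

definition L2_rel :: "'s measure \<Rightarrow> (('s \<Rightarrow> real) \<times> ('s \<Rightarrow> real)) set" where
  "L2_rel m = {(f, h). f \<in> square_integrable m \<and> h \<in> square_integrable m \<and>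
                       (AE s in m. f s = h s)}"

definition L2 :: "'s measure \<Rightarrow> ('s \<Rightarrow> real) set set" where
  "L2 m = square_integrable m // L2_rel m"

definition L2_class :: "'s measure \<Rightarrow> ('s \<Rightarrow> real) \<Rightarrow> ('s \<Rightarrow> real) set" where
  "L2_class m f = L2_rel m `` {f}"

definition L2_add ::
    "'s measure \<Rightarrow> ('s \<Rightarrow> real) set \<Rightarrow> ('s \<Rightarrow> real) set \<Rightarrow> ('s \<Rightarrow> real) set" where
  "L2_add m U V = (\<Union>f\<in>U. \<Union>h\<in>V. L2_class m (\<lambda>s. f s + h s))"

definition L2_scale :: "'s measure \<Rightarrow> real \<Rightarrow> ('s \<Rightarrow> real) set \<Rightarrow> ('s \<Rightarrow> real) set" where
  "L2_scale m c U = (\<Union>f\<in>U. L2_class m (\<lambda>s. c * f s))"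

text \<open>For \<open>U\<close> and \<open>V\<close> in \<open>L2 m\<close> the integral does not depend on the representatives.\<close>

definition L2_inner :: "'s measure \<Rightarrow> ('s \<Rightarrow> real) set \<Rightarrow> ('s \<Rightarrow> real) set \<Rightarrow> real" where
  "L2_inner m U V = (THE r. \<exists>f\<in>U. \<exists>h\<in>V. r = (LINT s|m. f s * h s))"


text \<open>The linear map from \<open>future_space M X\<close> to \<open>L\<^sup>2(\<mu>\<^sub>\<epsilon>)\<close> prescribed on the basis; it is made
  \<open>extensional\<close> so that it is unique as a HOL function.\<close>

definition future_embedding ::
    "'w measure \<Rightarrow> (int \<Rightarrow> 'w \<Rightarrow> 'o) \<Rightarrow> 'o list set
       \<Rightarrow> ('o list \<Rightarrow> real) \<Rightarrow> ((nat \<Rightarrow> 'o) \<Rightarrow> real) set" where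
  "future_embedding M X \<Lambda> = (THE \<phi>.
     \<phi> \<in> future_space M X \<rightarrow>\<^sub>E L2 (base_measure M X) \<and>
     (\<forall>u\<in>future_space M X. \<forall>v\<in>future_space M X.
        \<phi> (u + v) = L2_add (base_measure M X) (\<phi> u) (\<phi> v)) \<and>
     (\<forall>c. \<forall>u\<in>future_space M X. \<phi> (c *\<^sub>R u) = L2_scale (base_measure M X) c (\<phi> u)) \<and>
     (\<forall>a\<in>\<Lambda>. \<phi> (future_dist M X a) =
        L2_class (base_measure M X) (future_density M X (future_dist M X a))))"


definition inner_product_on :: "'v::real_vector set \<Rightarrow> ('v \<Rightarrow> 'v \<Rightarrow> real) \<Rightarrow> bool" where
  "inner_product_on V ip \<longleftrightarrow>
     subspace V \<and>
     (\<forall>u\<in>V. \<forall>v\<in>V. ip u v = ip v u) \<and>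
     (\<forall>u\<in>V. \<forall>v\<in>V. \<forall>w\<in>V. ip (u + v) w = ip u w + ip v w) \<and>
     (\<forall>c. \<forall>u\<in>V. \<forall>v\<in>V. ip (c *\<^sub>R u) v = c * ip u v) \<and>
     (\<forall>u\<in>V. 0 \<le> ip u u) \<and>
     (\<forall>u\<in>V. ip u u = 0 \<longrightarrow> u = 0)"

definition future_inner ::
    "'w measure \<Rightarrow> (int \<Rightarrow> 'w \<Rightarrow> 'o) \<Rightarrow> 'o list set
       \<Rightarrow> ('o list \<Rightarrow> real) \<Rightarrow> ('o list \<Rightarrow> real) \<Rightarrow> real" where
  "future_inner M X \<Lambda> g\<^sub>1 g\<^sub>2 =
     L2_inner (base_measure M X) (future_embedding M X \<Lambda> g\<^sub>1) (future_embedding M X \<Lambda> g\<^sub>2)"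

end

theory Submission
  imports Defs
begin

text \<open>
  Bilinearity, symmetry and semidefiniteness are inherited from \<open>L\<^sup>2(\<mu>\<^sub>\<epsilon>)\<close> through the linear
  map \<open>\<phi>\<close>, so two points need an argument: that the densities \<open>\<gamma>(g\<^sub>a)\<close> are square integrable, and
  that \<open>\<phi>\<close> is injective.

  For the first, \<open>\<mu>\<^sub>a\<close> is realised on the probability space of the process: it is the law of the
  path that starts right after time \<open>|a|\<close>, conditioned on the event that the first \<open>|a|\<close> symbols
  form \<open>a\<close>. Conditioning on an event of probability \<open>P(a)\<close> increases probabilities at most by the
  factor \<open>1 / P(a)\<close>, and by stationarity the unconditioned law of the shifted path is \<open>\<mu>\<^sub>\<epsilon>\<close>. Hence
  \<open>\<mu>\<^sub>a \<le> \<mu>\<^sub>\<epsilon> / P(a)\<close> (read as zero on the right if \<open>P(a) = 0\<close>, when \<open>\<mu>\<^sub>a\<close> is null;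
  \<open>conditional_future_le\<close>), and so \<open>\<gamma>(g\<^sub>a) \<le> 1 / P(a)\<close> almost everywhere
  (\<open>RN_deriv_dominated\<close>); a bounded function is square integrable for the finite measure \<open>\<mu>\<^sub>\<epsilon>\<close>.

  For the second, integrating \<open>\<gamma>(g\<^sub>a)\<close> over the cylinder of a string \<open>b\<close> returns
  \<open>\<mu>\<^sub>a(E(b)) = g\<^sub>a(b)\<close>, and by linearity integrating any representative of \<open>\<phi>(u)\<close> over that
  cylinder returns \<open>u(b)\<close> (\<open>integral_extension_cylinder\<close>). If \<open>\<langle>u, u\<rangle> = 0\<close>, the representative
  vanishes almost everywhere, hence \<open>u(b) = 0\<close> for every \<open>b\<close>.

  The measures \<open>\<mu>\<^sub>a\<close> and the map \<open>\<phi>\<close> are given by definite descriptions, which are resolved by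
  \<open>future_measure_eqI\<close> and \<open>future_embedding_eq\<close>. Linear algebra is done with functions rather than
  classes: \<open>\<gamma>\<close> on the basis extends to a linear map \<open>L\<close> into the space of all functions, and
  \<open>\<phi>(u)\<close> is the class of \<open>L u\<close>.
\<close>

section \<open>Pointwise operations on functions\<close>

lemma scaleR_fun_apply: "(c *\<^sub>R f) x = c *\<^sub>R f x"
  by (simp add: scaleR_fun_def)

lemma sum_fun_apply: "(\<Sum>i\<in>I. f i) x = (\<Sum>i\<in>I. f i x)"
  for f :: "'i \<Rightarrow> 'a \<Rightarrow> 'b::comm_monoid_add"
  by (induction I rule: infinite_finite_induct) auto

section \<open>Measures on the space of infinite sequences\<close>

definition path_space :: "(nat \<Rightarrow> 'o) measure" where
  "path_space = sigma UNIV cylinder_algebra"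

text \<open>A smaller generator of the same sigma-algebra over a countable alphabet. The empty set is
  adjoined so that the family is closed under intersections.\<close>
definition cylinders :: "(nat \<Rightarrow> 'o) set set" where
  "cylinders = insert {} (range cylinder)"

lemma cylinder_Nil [simp]: "cylinder [] = UNIV"
  by (simp add: cylinder_def)

lemma cylinder_mono_or_disjoint:
  assumes "length b \<le> length c"
  shows "cylinder c \<subseteq> cylinder b \<or> cylinder b \<inter> cylinder c = {}"
proof (cases "\<forall>i<length b. b ! i = c ! i")
  case True
  with assms show ?thesis by (auto simp: cylinder_def)
next
  case False
  then obtain i where "i < length b" "b ! i \<noteq> c ! i" by blast
  with assms have "cylinder b \<inter> cylinder c = {}"
    by (auto simp: cylinder_def intro!: exI[of _ i])
  then show ?thesis ..
qed

text \<open>Two cylinders are nested or disjoint according to whether one string is a prefix of the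
  other.\<close>
lemma Int_stable_cylinders: "Int_stable cylinders"
proof (rule Int_stableI)
  fix A B :: "(nat \<Rightarrow> 'a) set" assume AB: "A \<in> cylinders" "B \<in> cylinders"
  show "A \<inter> B \<in> cylinders"
  proof (cases "A = {} \<or> B = {}")
    case True
    then show ?thesis by (auto simp: cylinders_def)
  next
    case False
    with AB obtain b c where bc: "A = cylinder b" "B = cylinder c"
      by (auto simp: cylinders_def)
    have "A \<inter> B = A \<or> A \<inter> B = B \<or> A \<inter> B = {}"
      using cylinder_mono_or_disjoint[of b c] cylinder_mono_or_disjoint[of c b] bc
      by (cases "length b \<le> length c") auto
    then show ?thesis using bc by (auto simp: cylinders_def)
  qed
qed

lemma disjoint_cylinders:
  assumes "K \<subseteq> {b. length b = k}"
  shows "disjoint_family_on cylinder K"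
  unfolding disjoint_family_on_def
proof (intro ballI impI)
  fix b c assume "b \<in> K" "c \<in> K" "b \<noteq> c"
  with assms have "length b = k" "length c = k" by auto
  with \<open>b \<noteq> c\<close> obtain i where "i < k" "b ! i \<noteq> c ! i"
    using nth_equalityI by metis
  with \<open>length b = k\<close> \<open>length c = k\<close> show "cylinder b \<inter> cylinder c = {}"
    by (auto simp: cylinder_def intro!: exI[of _ i])
qed

lemma UN_cylinder_length: "(\<Union>b\<in>{b. length b = k}. cylinder b) = UNIV"
proof -
  have "s \<in> (\<Union>b\<in>{b. length b = k}. cylinder b)" for s :: "nat \<Rightarrow> 'a"
    by (rule UN_I[of "map s [0..<k]"]) (simp_all add: cylinder_def)
  then show ?thesis by blast
qed

text \<open>This rests on countability of the alphabet: a member of the algebra is a union over an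
  arbitrary set of strings of equal length, and there are only countably many strings.\<close>
lemma sets_path_space:
  "sets (path_space :: (nat \<Rightarrow> 'o::countable) measure) = sigma_sets UNIV cylinders"
proof -
  have "(\<Union>b\<in>K. cylinder b) \<in> sigma_sets UNIV cylinders" for K :: "'o list set"
    by (intro sigma_sets_UNION) (auto simp: cylinders_def)
  moreover have "cylinder b \<in> sigma_sets UNIV cylinder_algebra" for b :: "'o list"
  proof (cases "b = []")
    case True
    then show ?thesis by (simp add: sigma_sets_top)
  next
    case False
    then have "cylinder b \<in> cylinder_algebra"
      unfolding cylinder_algebra_def
      by (intro CollectI exI[of _ "length b"] exI[of _ "{b}"]) (auto simp: Suc_le_eq)
    then show ?thesis by (rule sigma_sets.Basic)
  qed
  ultimately have "sigma_sets UNIV (cylinder_algebra :: (nat \<Rightarrow> 'o) set set) = sigma_sets UNIV cylinders"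
    by (intro sigma_sets_eqI)
      (auto simp: cylinders_def cylinder_algebra_def intro: sigma_sets.Empty)
  then show ?thesis by (simp add: path_space_def)
qed

lemma space_path_space [simp]: "space path_space = UNIV"
  by (simp add: path_space_def)

lemma cylinder_sets [measurable, simp]:
  "cylinder b \<in> sets (path_space :: (nat \<Rightarrow> 'o::countable) measure)"
  unfolding sets_path_space by (rule sigma_sets.Basic) (simp add: cylinders_def)

text \<open>This uniqueness principle serves twice: it identifies the measure with given future
  distribution, and it turns stationarity, a statement about strings, into shift invariance of the
  law of the whole path.\<close>
lemma finite_measure_eqI_cylinder:
  fixes m n :: "(nat \<Rightarrow> 'o::countable) measure"
  assumes "finite_measure m" "finite_measure n"
    and sets: "sets m = sets path_space" "sets n = sets path_space"
    and eq: "\<And>b. measure m (cylinder b) = measure n (cylinder b)"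
  shows "m = n"
proof (rule measure_eqI_generator_eq[OF Int_stable_cylinders, of UNIV])
  interpret m: finite_measure m by fact
  interpret n: finite_measure n by fact
  show "emeasure m A = emeasure n A" if "A \<in> cylinders" for A
    using that by (auto simp: cylinders_def m.emeasure_eq_measure n.emeasure_eq_measure eq)
  show "sets m = sigma_sets UNIV cylinders" "sets n = sigma_sets UNIV cylinders"
    using sets by (simp_all only: sets_path_space)
  show "range (\<lambda>_::nat. UNIV) \<subseteq> (cylinders :: (nat \<Rightarrow> 'o) set set)"
    by (metis cylinder_Nil cylinders_def image_subsetI insertI2 rangeI)
  show "emeasure m UNIV \<noteq> \<infinity>" by simp
qed auto

text \<open>Countable additivity as an unordered sum of reals, obtained by reading the measure of the
  union as an integral over counting measure.\<close>
lemma (in finite_measure) has_sum_measure_UN: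
  assumes "countable I" "disjoint_family_on A I" "\<And>i. i \<in> I \<Longrightarrow> A i \<in> sets M"
  shows "((\<lambda>i. measure M (A i)) has_sum measure M (\<Union>i\<in>I. A i)) I"
proof -
  have eq: "(\<integral>\<^sup>+i. ennreal (measure M (A i)) \<partial>count_space I) = ennreal (measure M (\<Union>i\<in>I. A i))"
    using emeasure_UN_countable[of I A M] assms
    by (simp add: emeasure_eq_measure)
  have "integrable (count_space I) (\<lambda>i. measure M (A i))"
    by (rule integrableI_nonneg) (auto simp: eq)
  then have summable: "Infinite_Set_Sum.abs_summable_on (\<lambda>i. measure M (A i)) I"
    by (simp add: Infinite_Set_Sum.abs_summable_on_def)
  then have "(\<lambda>i. measure M (A i)) summable_on I"
    by (rule abs_summable_summable[OF abs_summable_equivalent[THEN iffD2]])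
  moreover have "infsum (\<lambda>i. measure M (A i)) I = measure M (\<Union>i\<in>I. A i)"
    using nn_integral_conv_infsetsum[OF summable] eq infsetsum_infsum[OF summable]
    by (simp add: infsum_nonneg)
  ultimately show ?thesis
    by (simp add: has_sum_iff)
qed

text \<open>Prescribing the values on single cylinders is enough to determine the measure: values on
  unions of cylinders of equal length follow by countable additivity, and uniqueness holds because
  cylinders generate.\<close>
lemma future_measure_eqI:
  fixes m :: "(nat \<Rightarrow> 'o::countable) measure"
  assumes sets: "sets m = sets path_space" and fin: "finite_measure m"
    and g: "\<And>b. measure m (cylinder b) = g b"
  shows "future_measure g = m"
  unfolding future_measure_def path_space_def[symmetric]
proof (rule the_equality, intro conjI allI impI)
  interpret finite_measure m by fact
  fix k :: nat and K :: "'o list set" assume "K \<subseteq> {b. length b = k}"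
  then have "((\<lambda>b. measure m (cylinder b)) has_sum measure m (\<Union>b\<in>K. cylinder b)) K"
    by (intro has_sum_measure_UN disjoint_cylinders) (auto simp: sets)
  then show "(g has_sum measure m (\<Union>b\<in>K. cylinder b)) K"
    by (simp only: g)
next
  fix n assume n: "sets n = sets path_space \<and> finite_measure n \<and>
    (\<forall>k\<ge>1. \<forall>K\<subseteq>{b. length b = k}. (g has_sum measure n (\<Union>b\<in>K. cylinder b)) K)"
  interpret finite_measure m by fact
  have "measure n (cylinder b) = g b" for b :: "'o list"
  proof (cases "b = []")
    case True
    \<comment> \<open>The defining property speaks of strings of positive length only, so the total mass is
      recovered from the partition of the path space by the first symbol.\<close>
    let ?K = "{b :: 'o list. length b = 1}"
    have "(g has_sum measure n (\<Union>b\<in>?K. cylinder b)) ?K" using n by blast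
    moreover have "((\<lambda>b. measure m (cylinder b)) has_sum measure m (\<Union>b\<in>?K. cylinder b)) ?K"
      by (intro has_sum_measure_UN disjoint_cylinders) (auto simp: sets)
    ultimately show ?thesis
      using True g[of "[]"] by (auto simp: g UN_cylinder_length dest: has_sum_unique)
  next
    case False
    then have "1 \<le> length b" by (simp add: Suc_le_eq)
    with n have "(g has_sum measure n (\<Union>b\<in>{b}. cylinder b)) {b}" by blast
    then show ?thesis using has_sum_finite[of "{b}" g] has_sum_unique by fastforce
  qed
  then show "n = m"
    using n fin sets by (intro finite_measure_eqI_cylinder) (auto simp: g)
qed (simp_all add: sets fin)


section \<open>Operations on classes of square-integrable functions\<close>

lemma square_integrableD:
  assumes "f \<in> square_integrable m"
  shows "f \<in> borel_measurable m" "integrable m (\<lambda>s. (f s)\<^sup>2)"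
  using assms by (auto simp: square_integrable_def)

lemma square_integrable_mult:
  assumes "f \<in> square_integrable m" "h \<in> square_integrable m"
  shows "integrable m (\<lambda>s. f s * h s)"
proof (rule Bochner_Integration.integrable_bound)
  note [measurable] = square_integrableD(1)[OF assms(1)] square_integrableD(1)[OF assms(2)]
  show "integrable m (\<lambda>s. (f s)\<^sup>2 + (h s)\<^sup>2)"
    using assms by (auto dest: square_integrableD)
  show "(\<lambda>s. f s * h s) \<in> borel_measurable m" by measurable
  have "\<bar>x * y\<bar> \<le> x\<^sup>2 + y\<^sup>2" for x y :: real
    using sum_squares_bound[of "\<bar>x\<bar>" "\<bar>y\<bar>"] abs_ge_zero[of "x * y"]
    by (simp only: abs_mult power2_abs mult.assoc)
  then show "AE s in m. norm (f s * h s) \<le> norm ((f s)\<^sup>2 + (h s)\<^sup>2)"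
    by simp
qed

lemma subspace_square_integrable: "subspace (square_integrable m)"
proof (rule subspaceI)
  show "0 \<in> square_integrable m"
    by (simp add: square_integrable_def zero_fun_def)
next
  fix f h assume fh: "f \<in> square_integrable m" "h \<in> square_integrable m"
  note [measurable] = square_integrableD(1)[OF fh(1)] square_integrableD(1)[OF fh(2)]
  have "integrable m (\<lambda>s. (f s)\<^sup>2 + (h s)\<^sup>2 + 2 * (f s * h s))"
    using fh by (intro Bochner_Integration.integrable_add integrable_mult_right
        square_integrable_mult) (auto dest: square_integrableD)
  then have "integrable m (\<lambda>s. (f s + h s)\<^sup>2)"
    by (simp add: power2_sum mult.assoc)
  then show "f + h \<in> square_integrable m"
    by (simp add: square_integrable_def plus_fun_def)
next
  fix c and f assume f: "f \<in> square_integrable m"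
  note [measurable] = square_integrableD(1)[OF f]
  show "c *\<^sub>R f \<in> square_integrable m"
    using square_integrableD(2)[OF f]
    by (simp add: square_integrable_def scaleR_fun_def power_mult_distrib)
qed

lemma L2_class_eq_Collect:
  assumes "f \<in> square_integrable m"
  shows "L2_class m f = {h \<in> square_integrable m. AE s in m. f s = h s}"
  using assms by (auto simp: L2_class_def L2_rel_def)

lemma L2_class_self: "f \<in> square_integrable m \<Longrightarrow> f \<in> L2_class m f"
  by (simp add: L2_class_eq_Collect)

lemma L2_class_in_L2: "f \<in> square_integrable m \<Longrightarrow> L2_class m f \<in> L2 m"
  by (auto simp: L2_class_def L2_def intro: quotientI)

lemma L2_class_cong:
  assumes "f \<in> square_integrable m" "h \<in> square_integrable m" "AE s in m. f s = h s"
  shows "L2_class m f = L2_class m h"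
proof -
  have "(AE s in m. f s = k s) \<longleftrightarrow> (AE s in m. h s = k s)" for k
    using assms(3) by (intro iffI; elim AE_mp) auto
  with assms(1,2) show ?thesis by (simp add: L2_class_eq_Collect)
qed

text \<open>This and the next two lemmas say that the operations on classes may be computed on arbitrary
  representatives, because changing these on null sets changes sums, multiples and products on
  null sets only.\<close>
lemma L2_add_class:
  assumes f: "f \<in> square_integrable m" and h: "h \<in> square_integrable m"
  shows "L2_add m (L2_class m f) (L2_class m h) = L2_class m (f + h)"
proof -
  have "L2_class m (\<lambda>s. f' s + h' s) = L2_class m (f + h)"
    if "f' \<in> L2_class m f" "h' \<in> L2_class m h" for f' h'
  proof -
    have f': "f' \<in> square_integrable m" "AE s in m. f s = f' s"
      and h': "h' \<in> square_integrable m" "AE s in m. h s = h' s"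
      using that f h by (auto simp: L2_class_eq_Collect)
    have "AE s in m. (f' + h') s = (f + h) s"
      using f'(2) h'(2) by eventually_elim simp
    then have "L2_class m (f' + h') = L2_class m (f + h)"
      by (intro L2_class_cong subspace_add[OF subspace_square_integrable] f h f' h')
    then show ?thesis by (simp add: plus_fun_def)
  qed
  then have "L2_add m (L2_class m f) (L2_class m h) =
      (\<Union>f'\<in>L2_class m f. \<Union>h'\<in>L2_class m h. L2_class m (f + h))"
    unfolding L2_add_def by (intro SUP_cong refl)
  also have "\<dots> = L2_class m (f + h)"
    using L2_class_self[OF f] L2_class_self[OF h] by blast
  finally show ?thesis .
qed

lemma L2_scale_class:
  assumes f: "f \<in> square_integrable m"
  shows "L2_scale m c (L2_class m f) = L2_class m (c *\<^sub>R f)"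
proof -
  have "L2_class m (\<lambda>s. c * f' s) = L2_class m (c *\<^sub>R f)" if "f' \<in> L2_class m f" for f'
  proof -
    have f': "f' \<in> square_integrable m" "AE s in m. f s = f' s"
      using that f by (auto simp: L2_class_eq_Collect)
    have "AE s in m. (c *\<^sub>R f') s = (c *\<^sub>R f) s"
      using f'(2) by eventually_elim (simp add: scaleR_fun_def)
    then have "L2_class m (c *\<^sub>R f') = L2_class m (c *\<^sub>R f)"
      by (intro L2_class_cong subspace_scale[OF subspace_square_integrable] f f')
    then show ?thesis by (simp add: scaleR_fun_def)
  qed
  then have "L2_scale m c (L2_class m f) = (\<Union>f'\<in>L2_class m f. L2_class m (c *\<^sub>R f))"
    unfolding L2_scale_def by (intro SUP_cong refl)
  also have "\<dots> = L2_class m (c *\<^sub>R f)"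
    using L2_class_self[OF f] by blast
  finally show ?thesis .
qed

lemma L2_inner_class:
  assumes f: "f \<in> square_integrable m" and h: "h \<in> square_integrable m"
  shows "L2_inner m (L2_class m f) (L2_class m h) = (LINT s|m. f s * h s)"
  unfolding L2_inner_def
proof (rule the_equality)
  show "\<exists>f'\<in>L2_class m f. \<exists>h'\<in>L2_class m h. (LINT s|m. f s * h s) = (LINT s|m. f' s * h' s)"
    using L2_class_self[OF f] L2_class_self[OF h] by blast
next
  fix r assume "\<exists>f'\<in>L2_class m f. \<exists>h'\<in>L2_class m h. r = (LINT s|m. f' s * h' s)"
  then obtain f' h' where r: "r = (LINT s|m. f' s * h' s)"
    and f': "f' \<in> square_integrable m" "AE s in m. f s = f' s"
    and h': "h' \<in> square_integrable m" "AE s in m. h s = h' s"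
    using f h by (auto simp: L2_class_eq_Collect)
  note [measurable] = f[THEN square_integrableD(1)] h[THEN square_integrableD(1)]
    f'(1)[THEN square_integrableD(1)] h'(1)[THEN square_integrableD(1)]
  have "AE s in m. f' s * h' s = f s * h s"
    using f'(2) h'(2) by eventually_elim simp
  then show "r = (LINT s|m. f s * h s)"
    unfolding r by (intro integral_cong_AE) auto
qed

section \<open>Bounded densities\<close>

lemma (in finite_measure) square_integrable_bounded:
  fixes f :: "'a \<Rightarrow> real"
  assumes "f \<in> borel_measurable M" "AE s in M. \<bar>f s\<bar> \<le> c"
  shows "f \<in> square_integrable M"
proof -
  have "integrable M (\<lambda>s. (f s)\<^sup>2)"
  proof (rule integrable_const_bound)
    show "AE s in M. norm ((f s)\<^sup>2) \<le> c\<^sup>2"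
      using assms(2) by eventually_elim (simp add: power2_le_iff_abs_le order_trans[OF abs_ge_zero])
  qed (use assms(1) in measurable)
  with assms(1) show ?thesis by (simp add: square_integrable_def)
qed

text \<open>On the set \<open>A\<close> where the density exceeds \<open>c\<close>, domination forces the integral of the
  nonnegative excess to be zero, so \<open>A\<close> is a null set.\<close>
lemma (in finite_measure) RN_deriv_dominated:
  assumes sets: "sets N = sets M"
    and le: "\<And>A. A \<in> sets M \<Longrightarrow> emeasure N A \<le> ennreal c * emeasure M A"
  shows "density M (RN_deriv M N) = N" "AE s in M. RN_deriv M N s \<le> ennreal c"
proof -
  have "absolutely_continuous M N"
    unfolding absolutely_continuous_def
    using le sets by (fastforce simp: null_sets_def)
  then show dens: "density M (RN_deriv M N) = N"
    by (rule density_RN_deriv[OF _ sets])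
  let ?f = "RN_deriv M N"
  let ?A = "{s \<in> space M. ennreal c < ?f s}"
  have A: "?A \<in> sets M" by measurable
  have f_A: "(\<integral>\<^sup>+s. ?f s * indicator ?A s \<partial>M) = emeasure N ?A"
    using arg_cong[OF dens, of "\<lambda>m. emeasure m ?A"] A by (simp add: emeasure_density)
  have c_A: "(\<integral>\<^sup>+s. ennreal c * indicator ?A s \<partial>M) = ennreal c * emeasure M ?A"
    using A by (simp add: nn_integral_cmult)
  have "(\<integral>\<^sup>+s. ?f s * indicator ?A s - ennreal c * indicator ?A s \<partial>M) =
      (\<integral>\<^sup>+s. ?f s * indicator ?A s \<partial>M) - (\<integral>\<^sup>+s. ennreal c * indicator ?A s \<partial>M)"
  proof (rule nn_integral_diff)
    show "(\<integral>\<^sup>+s. ennreal c * indicator ?A s \<partial>M) \<noteq> \<infinity>"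
      unfolding c_A by (simp add: ennreal_mult_eq_top_iff)
    show "AE s in M. ennreal c * indicator ?A s \<le> ?f s * indicator ?A s"
      by (auto simp: indicator_def)
  qed measurable
  also have "\<dots> = 0"
  proof -
    have "emeasure N ?A < \<top>"
      using le[OF A]
      by (rule order.strict_trans1) (simp add: ennreal_mult_less_top emeasure_eq_measure)
    then show ?thesis
      unfolding f_A c_A using le[OF A] by (simp add: diff_eq_0_iff_ennreal)
  qed
  finally have int_0: "(\<integral>\<^sup>+s. ?f s * indicator ?A s - ennreal c * indicator ?A s \<partial>M) = 0" .
  have "(\<lambda>s. ?f s * indicator ?A s - ennreal c * indicator ?A s) \<in> borel_measurable M"
    by measurable
  from nn_integral_0_iff_AE[OF this] int_0
  have "AE s in M. ?f s * indicator ?A s - ennreal c * indicator ?A s = 0"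
    by blast
  then show "AE s in M. ?f s \<le> ennreal c"
    using AE_space
  proof eventually_elim
    case (elim s)
    then show ?case
      by (cases "s \<in> ?A") (auto simp: diff_eq_0_iff_ennreal not_less)
  qed
qed

section \<open>Future measures as conditional laws of the process\<close>

definition future_path :: "(int \<Rightarrow> 'w \<Rightarrow> 'o) \<Rightarrow> nat \<Rightarrow> 'w \<Rightarrow> nat \<Rightarrow> 'o" where
  "future_path X k w = (\<lambda>i. X (1 + int (k + i)) w)"

definition past_event :: "'w measure \<Rightarrow> (int \<Rightarrow> 'w \<Rightarrow> 'o) \<Rightarrow> 'o list \<Rightarrow> 'w set" where
  "past_event M X a = {w \<in> space M. \<forall>i<length a. X (1 + int i) w = a ! i}"

text \<open>The law of the path after time \<open>|a|\<close>, given that the process starts with \<open>a\<close>. Since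
  \<open>1 / 0 = 0\<close>, this is the null measure if \<open>a\<close> has probability zero, in agreement with the
  convention for \<open>future_dist\<close>.\<close>
definition conditional_future ::
    "'w measure \<Rightarrow> (int \<Rightarrow> 'w \<Rightarrow> 'o) \<Rightarrow> 'o list \<Rightarrow> (nat \<Rightarrow> 'o) measure" where
  "conditional_future M X a =
     distr (density M (\<lambda>w. ennreal (1 / string_prob M X a) * indicator (past_event M X a) w))
       path_space (future_path X (length a))"

locale stationary_source =
  fixes M :: "'w measure" and X :: "int \<Rightarrow> 'w \<Rightarrow> 'o::countable"
  assumes stationary: "stationary_process M X"
begin

sublocale prob_space M
  using stationary unfolding stationary_process_def by blast

lemma measurable_X [measurable]: "X t \<in> measurable M (count_space UNIV)"
  using stationary unfolding stationary_process_def by blast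

lemma past_event_sets [measurable]: "past_event M X a \<in> sets M"
  unfolding past_event_def by measurable

lemma string_prob_eq: "string_prob M X a = measure M (past_event M X a)"
  by (simp add: string_prob_def past_event_def)

lemma measurable_future_path [measurable]: "future_path X k \<in> measurable M path_space"
proof (rule measurable_sigma_sets[OF sets_path_space])
  fix A :: "(nat \<Rightarrow> 'o) set" assume "A \<in> cylinders"
  moreover have "future_path X k -` cylinder b \<inter> space M =
      {w \<in> space M. \<forall>i<length b. X (1 + int (k + i)) w = b ! i}" for b
    by (auto simp: future_path_def cylinder_def)
  then have "future_path X k -` cylinder b \<inter> space M \<in> sets M" for b
    by simp
  ultimately show "future_path X k -` A \<inter> space M \<in> sets M"
    by (auto simp: cylinders_def)
qed simp_all

lemma string_prob_shift:
  "measure M (future_path X k -` cylinder b \<inter> space M) = string_prob M X b"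
proof -
  let ?ts = "map (\<lambda>i. 1 + int i) [0..<length b]"
  have "measure M {w \<in> space M. \<forall>i<length b. X (?ts ! i) w = b ! i} =
      measure M {w \<in> space M. \<forall>i<length b. X (?ts ! i + int k) w = b ! i}"
    by (rule stationary[unfolded stationary_process_def, THEN conjunct2, THEN conjunct2, rule_format])
      simp
  moreover have "{w \<in> space M. \<forall>i<length b. X (?ts ! i) w = b ! i} = past_event M X b"
    by (auto simp: past_event_def)
  moreover have "{w \<in> space M. \<forall>i<length b. X (?ts ! i + int k) w = b ! i} =
      future_path X k -` cylinder b \<inter> space M"
    by (auto simp: future_path_def cylinder_def algebra_simps)
  ultimately show ?thesis by (simp add: string_prob_eq)
qed

text \<open>Starting with \<open>a\<close> and continuing with \<open>b\<close> after time \<open>|a|\<close> means starting with \<open>a @ b\<close>; so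
  \<open>conditional_future M X a\<close> has the cylinder probabilities \<open>P(ab) / P(a)\<close>.\<close>
lemma past_event_append:
  "past_event M X a \<inter> (future_path X (length a) -` cylinder b \<inter> space M) = past_event M X (a @ b)"
proof (intro set_eqI iffI)
  fix w assume w: "w \<in> past_event M X a \<inter> (future_path X (length a) -` cylinder b \<inter> space M)"
  have "X (1 + int i) w = (a @ b) ! i" if "i < length (a @ b)" for i
  proof (cases "i < length a")
    case True
    with w show ?thesis by (simp add: past_event_def nth_append)
  next
    case False
    then have "i - length a < length b" "length a + (i - length a) = i" using that by auto
    with w False show ?thesis
      by (auto simp: future_path_def cylinder_def nth_append dest!: spec[of _ "i - length a"])
  qed
  with w show "w \<in> past_event M X (a @ b)" by (simp add: past_event_def)
next
  fix w assume w: "w \<in> past_event M X (a @ b)"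
  then have eq: "X (1 + int i) w = (a @ b) ! i" if "i < length a + length b" for i
    using that by (simp add: past_event_def)
  have "X (1 + int i) w = a ! i" if "i < length a" for i
    using eq[of i] that by (simp add: nth_append)
  moreover have "X (1 + int (length a + i)) w = b ! i" if "i < length b" for i
    using eq[of "length a + i"] that by (simp only: nth_append_length_plus)
  ultimately show "w \<in> past_event M X a \<inter> (future_path X (length a) -` cylinder b \<inter> space M)"
    using w by (auto simp: past_event_def future_path_def cylinder_def)
qed

lemma sets_conditional_future [simp]: "sets (conditional_future M X a) = sets path_space"
  by (simp add: conditional_future_def)

lemma emeasure_conditional_future:
  assumes "A \<in> sets path_space"
  shows "emeasure (conditional_future M X a) A =
    ennreal (1 / string_prob M X a) *
      emeasure M (past_event M X a \<inter> (future_path X (length a) -` A \<inter> space M))"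
proof -
  have [measurable]: "future_path X (length a) -` A \<inter> space M \<in> sets M"
    using assms by measurable
  show ?thesis
    using assms unfolding conditional_future_def
    by (simp add: emeasure_distr emeasure_density mult.assoc nn_integral_cmult
        flip: indicator_inter_arith)
qed

lemma finite_measure_conditional_future: "finite_measure (conditional_future M X a)"
proof (rule finite_measureI)
  have "space (conditional_future M X a) = UNIV"
    by (simp add: conditional_future_def)
  then show "emeasure (conditional_future M X a) (space (conditional_future M X a)) \<noteq> \<infinity>"
    using sets.top[of "path_space :: (nat \<Rightarrow> 'o) measure"]
    by (simp add: emeasure_conditional_future ennreal_mult_eq_top_iff)
qed

lemma future_dist_eq: "future_dist M X a b = string_prob M X (a @ b) / string_prob M X a"
  by (simp add: future_dist_def)

lemma measure_conditional_future_cylinder: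
  "measure (conditional_future M X a) (cylinder b) = future_dist M X a b"
  unfolding measure_def
  by (simp add: emeasure_conditional_future past_event_append future_dist_eq
      emeasure_eq_measure enn2real_mult string_prob_eq)

lemma future_measure_future_dist:
  "future_measure (future_dist M X a) = conditional_future M X a"
  by (rule future_measure_eqI)
    (simp_all add: finite_measure_conditional_future measure_conditional_future_cylinder)

lemma string_prob_Nil [simp]: "string_prob M X [] = 1"
  by (simp add: string_prob_def prob_space)

text \<open>Stationarity makes the law of the path independent of its starting time, and for starting
  time one it is \<open>\<mu>\<^sub>\<epsilon>\<close>.\<close>
lemma distr_future_path: "distr M path_space (future_path X k) = base_measure M X"
proof -
  have "future_measure (future_dist M X []) = distr M path_space (future_path X k)"
  proof (rule future_measure_eqI)
    show "finite_measure (distr M path_space (future_path X k))"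
      by (rule finite_measure_distr) simp
    show "measure (distr M path_space (future_path X k)) (cylinder b) = future_dist M X [] b" for b
      by (simp add: measure_distr string_prob_shift future_dist_eq)
  qed simp
  then show ?thesis by (simp add: base_measure_def)
qed

lemma sets_base_measure [simp, measurable_cong]: "sets (base_measure M X) = sets path_space"
  by (simp flip: distr_future_path[of 0])

lemma finite_measure_base_measure: "finite_measure (base_measure M X)"
  unfolding distr_future_path[of 0, symmetric] by (rule finite_measure_distr) simp

text \<open>Dropping the conditioning event leaves the law of the path after time \<open>|a|\<close>, scaled by
  \<open>1 / P(a)\<close>. This is where stationarity enters: that law is \<open>\<mu>\<^sub>\<epsilon>\<close>.\<close>
lemma conditional_future_le:
  assumes "A \<in> sets path_space"
  shows "emeasure (conditional_future M X a) A \<le>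
    ennreal (1 / string_prob M X a) * emeasure (base_measure M X) A"
proof -
  have "emeasure (base_measure M X) A = emeasure M (future_path X (length a) -` A \<inter> space M)"
    using assms by (simp add: emeasure_distr flip: distr_future_path[of "length a"])
  then show ?thesis
    unfolding emeasure_conditional_future[OF assms]
    using assms by (auto intro!: mult_left_mono emeasure_mono)
qed

lemma future_density_eq:
  "future_density M X (future_dist M X a) s =
     enn2real (RN_deriv (base_measure M X) (conditional_future M X a) s)"
  by (simp add: future_density_def future_measure_future_dist)

lemma future_density_measurable [measurable]:
  "future_density M X (future_dist M X a) \<in> borel_measurable (base_measure M X)"
  unfolding future_density_eq[abs_def] by measurable

lemma density_RN_deriv_conditional_future:
  "density (base_measure M X) (RN_deriv (base_measure M X) (conditional_future M X a)) =
     conditional_future M X a"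
  by (rule finite_measure.RN_deriv_dominated[OF finite_measure_base_measure])
    (auto intro: conditional_future_le)

lemma RN_deriv_conditional_future_le:
  "AE s in base_measure M X.
     RN_deriv (base_measure M X) (conditional_future M X a) s \<le> ennreal (1 / string_prob M X a)"
  by (rule finite_measure.RN_deriv_dominated[OF finite_measure_base_measure])
    (auto intro: conditional_future_le)

lemma future_density_square_integrable:
  "future_density M X (future_dist M X a) \<in> square_integrable (base_measure M X)"
proof (rule finite_measure.square_integrable_bounded[OF finite_measure_base_measure
      future_density_measurable])
  show "AE s in base_measure M X. \<bar>future_density M X (future_dist M X a) s\<bar> \<le> 1 / string_prob M X a"
    using RN_deriv_conditional_future_le[of a]
  proof eventually_elim
    case (elim s)
    have "0 \<le> 1 / string_prob M X a" by (simp add: string_prob_eq)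
    with enn2real_mono[OF elim] show ?case by (simp add: future_density_eq)
  qed
qed

lemma integral_future_density_cylinder:
  "(LINT s|base_measure M X. future_density M X (future_dist M X a) s * indicator (cylinder b) s) =
     future_dist M X a b"
proof -
  let ?f = "future_density M X (future_dist M X a)"
  let ?R = "RN_deriv (base_measure M X) (conditional_future M X a)"
  have "(LINT s|base_measure M X. ?f s * indicator (cylinder b) s) =
      enn2real (\<integral>\<^sup>+s. ennreal (?f s * indicator (cylinder b) s) \<partial>base_measure M X)"
    by (intro integral_eq_nn_integral) (auto simp: future_density_def)
  also have "(\<integral>\<^sup>+s. ennreal (?f s * indicator (cylinder b) s) \<partial>base_measure M X) =
      (\<integral>\<^sup>+s. ?R s * indicator (cylinder b) s \<partial>base_measure M X)"
  proof (rule nn_integral_cong_AE)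
    show "AE s in base_measure M X.
        ennreal (?f s * indicator (cylinder b) s) = ?R s * indicator (cylinder b) s"
      using RN_deriv_conditional_future_le[of a]
    proof eventually_elim
      case (elim s)
      then have "?R s < \<top>" by (rule order.strict_trans1) simp
      then show ?case by (auto simp: future_density_eq indicator_def)
    qed
  qed
  also have "\<dots> = emeasure (density (base_measure M X) ?R) (cylinder b)"
    by (simp add: emeasure_density)
  also have "\<dots> = emeasure (conditional_future M X a) (cylinder b)"
    by (simp only: density_RN_deriv_conditional_future)
  finally show ?thesis
    by (simp add: measure_conditional_future_cylinder flip: measure_def)
qed

section \<open>The embedding into square-integrable functions\<close>

lemma future_dist_in_space: "future_dist M X a \<in> future_space M X"
  by (simp add: future_space_def span_base)

lemma subspace_future_space: "subspace (future_space M X)"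
  by (simp add: future_space_def)

end

text \<open>The range of \<open>L\<close> is the vector space of all functions, not a space of classes. So \<open>L\<close> exists
  by the extension theorem for linear maps on an independent set, and its values on the
  future space are linearly chosen representatives of the classes in the image of the embedding.\<close>
locale future_density_extension = stationary_source M X
  for M :: "'w measure" and X :: "int \<Rightarrow> 'w \<Rightarrow> 'o::countable" +
  fixes \<Lambda> :: "'o list set" and L :: "('o list \<Rightarrow> real) \<Rightarrow> (nat \<Rightarrow> 'o) \<Rightarrow> real"
  assumes basis: "future_basis M X \<Lambda>"
    and lin: "linear L"
    and L: "\<And>a. a \<in> \<Lambda> \<Longrightarrow> L (future_dist M X a) = future_density M X (future_dist M X a)"
begin

lemma extension_square_integrable:
  assumes u: "u \<in> future_space M X"
  shows "L u \<in> square_integrable (base_measure M X)"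
proof -
  have "u \<in> span (future_dist M X ` \<Lambda>)"
    using basis u by (simp add: future_basis_def)
  then have "L u \<in> span (L ` future_dist M X ` \<Lambda>)"
    by (simp add: linear_span_image[OF lin])
  moreover have "L ` future_dist M X ` \<Lambda> \<subseteq> square_integrable (base_measure M X)"
    using future_density_square_integrable by (auto simp: L)
  ultimately show ?thesis
    using span_minimal[OF _ subspace_square_integrable] by blast
qed

text \<open>This recovers \<open>u\<close> from its image and hence gives definiteness. Both sides are linear in \<open>u\<close>
  and agree on the basis.\<close>
lemma integral_extension_cylinder:
  assumes u: "u \<in> future_space M X"
  shows "(LINT s|base_measure M X. L u s * indicator (cylinder b) s) = u b"
proof -
  let ?m = "base_measure M X"
  interpret base: finite_measure ?m by (rule finite_measure_base_measure)
  let ?U = "{u \<in> future_space M X. (LINT s|?m. L u s * indicator (cylinder b) s) = u b}"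
  have ind: "indicator (cylinder b) \<in> square_integrable ?m"
    by (rule base.square_integrable_bounded[of _ 1]) (auto simp: indicator_def)
  note int = square_integrable_mult[OF extension_square_integrable ind]
  have "subspace ?U"
  proof (rule subspaceI)
    show "0 \<in> ?U"
      using subspace_0[OF subspace_future_space] by (simp add: linear_0[OF lin])
  next
    fix v w assume vw: "v \<in> ?U" "w \<in> ?U"
    then have "(LINT s|?m. L v s * indicator (cylinder b) s + L w s * indicator (cylinder b) s) =
        v b + w b"
      by (subst Bochner_Integration.integral_add) (auto intro: int)
    then show "v + w \<in> ?U"
      using vw subspace_add[OF subspace_future_space]
      by (simp add: linear_add[OF lin] distrib_right)
  next
    fix c v assume "v \<in> ?U"
    then show "c *\<^sub>R v \<in> ?U"
      using subspace_scale[OF subspace_future_space]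
      by (simp add: linear_scale[OF lin] scaleR_fun_apply mult.assoc)
  qed
  moreover have "future_dist M X ` \<Lambda> \<subseteq> ?U"
    by (auto simp: L future_dist_in_space integral_future_density_cylinder)
  ultimately have "span (future_dist M X ` \<Lambda>) \<subseteq> ?U"
    by (intro span_minimal)
  with u basis show ?thesis by (auto simp: future_basis_def)
qed

text \<open>The map sending \<open>u\<close> to the class of \<open>L u\<close> has the defining properties of the embedding. Any
  other map \<open>\<psi>\<close> with these properties agrees with it on a subspace containing the basis, thus on the
  whole space, and both have the same default value elsewhere.\<close>
lemma future_embedding_eq:
  assumes u: "u \<in> future_space M X"
  shows "future_embedding M X \<Lambda> u = L2_class (base_measure M X) (L u)"
proof -
  let ?V = "future_space M X" and ?m = "base_measure M X"
  define \<Phi> where "\<Phi> = restrict (\<lambda>u. L2_class ?m (L u)) ?V"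
  note sq = extension_square_integrable
  note add = subspace_add[OF subspace_future_space] and scale = subspace_scale[OF subspace_future_space]
  have "future_embedding M X \<Lambda> = \<Phi>"
    unfolding future_embedding_def
  proof (rule the_equality, intro conjI ballI allI)
    show "\<Phi> \<in> ?V \<rightarrow>\<^sub>E L2 ?m"
      unfolding \<Phi>_def by (auto intro: L2_class_in_L2 sq)
    show "\<Phi> (v + w) = L2_add ?m (\<Phi> v) (\<Phi> w)" if "v \<in> ?V" "w \<in> ?V" for v w
      using that by (simp add: \<Phi>_def add L2_add_class sq linear_add[OF lin])
    show "\<Phi> (c *\<^sub>R v) = L2_scale ?m c (\<Phi> v)" if "v \<in> ?V" for c v
      using that by (simp add: \<Phi>_def scale L2_scale_class sq linear_scale[OF lin])
    show "\<Phi> (future_dist M X a) = L2_class ?m (future_density M X (future_dist M X a))" if "a \<in> \<Lambda>" for a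
      using that by (simp add: \<Phi>_def future_dist_in_space L)
  next
    fix \<psi> assume \<psi>: "\<psi> \<in> ?V \<rightarrow>\<^sub>E L2 ?m \<and>
      (\<forall>u\<in>?V. \<forall>v\<in>?V. \<psi> (u + v) = L2_add ?m (\<psi> u) (\<psi> v)) \<and>
      (\<forall>c. \<forall>u\<in>?V. \<psi> (c *\<^sub>R u) = L2_scale ?m c (\<psi> u)) \<and>
      (\<forall>a\<in>\<Lambda>. \<psi> (future_dist M X a) = L2_class ?m (future_density M X (future_dist M X a)))"
    let ?U = "{v \<in> ?V. \<psi> v = L2_class ?m (L v)}"
    have "subspace ?U"
    proof (rule subspaceI)
      have 0: "0 \<in> ?V" by (rule subspace_0[OF subspace_future_space])
      then have "\<psi> 0 \<in> L2 ?m" using \<psi> by auto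
      then obtain f where f: "f \<in> square_integrable ?m" "\<psi> 0 = L2_class ?m f"
        by (auto simp: L2_def L2_class_def elim: quotientE)
      \<comment> \<open>The classes carry no vector space type, so that \<open>\<psi>\<close> preserves zero has to be
        derived from homogeneity with factor zero.\<close>
      have "\<psi> 0 = L2_scale ?m 0 (\<psi> 0)"
        using \<psi> 0 by (metis scaleR_zero_left)
      also have "\<dots> = L2_class ?m (L 0)"
        using f by (simp add: L2_scale_class linear_0[OF lin])
      finally show "0 \<in> ?U" using 0 by simp
    next
      fix v w assume "v \<in> ?U" "w \<in> ?U"
      then show "v + w \<in> ?U"
        using \<psi> by (simp add: add L2_add_class sq linear_add[OF lin])
    next
      fix c v assume "v \<in> ?U"
      then show "c *\<^sub>R v \<in> ?U"
        using \<psi> by (simp add: scale L2_scale_class sq linear_scale[OF lin])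
    qed
    moreover have "future_dist M X ` \<Lambda> \<subseteq> ?U"
      using \<psi> by (auto simp: L future_dist_in_space)
    ultimately have "span (future_dist M X ` \<Lambda>) \<subseteq> ?U"
      by (intro span_minimal)
    then have U: "\<psi> v = \<Phi> v" if "v \<in> ?V" for v
      using that basis by (auto simp: future_basis_def \<Phi>_def)
    show "\<psi> = \<Phi>"
    proof
      fix v
      show "\<psi> v = \<Phi> v"
      proof (cases "v \<in> ?V")
        case False
        then show ?thesis using PiE_arb[OF conjunct1[OF \<psi>]] by (simp add: \<Phi>_def)
      qed (rule U)
    qed
  qed
  with u show ?thesis by (simp add: \<Phi>_def)
qed

end

theorem theorem4p5:
  fixes M :: "'w measure"
    and X :: "int \<Rightarrow> 'w \<Rightarrow> 'o::countable"
    and \<Lambda> :: "'o list set"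
  assumes "stationary_process M X"
    and "future_basis M X \<Lambda>"
  shows "inner_product_on (future_space M X) (future_inner M X \<Lambda>) \<and>
    (\<forall>\<alpha> \<beta>. finite {a \<in> \<Lambda>. \<alpha> a \<noteq> 0} \<longrightarrow> finite {b \<in> \<Lambda>. \<beta> b \<noteq> 0} \<longrightarrow>
      has_bochner_integral (base_measure M X)
        (\<lambda>s. (\<Sum>a | a \<in> \<Lambda> \<and> \<alpha> a \<noteq> 0. \<alpha> a * future_density M X (future_dist M X a) s) *
             (\<Sum>b | b \<in> \<Lambda> \<and> \<beta> b \<noteq> 0. \<beta> b * future_density M X (future_dist M X b) s))
        (future_inner M X \<Lambda>
          (\<Sum>a | a \<in> \<Lambda> \<and> \<alpha> a \<noteq> 0. \<alpha> a *\<^sub>R future_dist M X a)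
          (\<Sum>b | b \<in> \<Lambda> \<and> \<beta> b \<noteq> 0. \<beta> b *\<^sub>R future_dist M X b)))"
proof -
  let ?V = "future_space M X" and ?m = "base_measure M X"
  have "independent (future_dist M X ` \<Lambda>)"
    using assms(2) by (simp add: future_basis_def)
  from linear_independent_extend[OF this, of "future_density M X"]
  obtain L where "linear L"
    and "\<And>a. a \<in> \<Lambda> \<Longrightarrow> L (future_dist M X a) = future_density M X (future_dist M X a)"
    by blast
  then interpret future_density_extension M X \<Lambda> L
    using assms by (intro future_density_extension.intro stationary_source.intro
        future_density_extension_axioms.intro)
  note sq = extension_square_integrable
  have int: "integrable ?m (\<lambda>s. L u s * L v s)" if "u \<in> ?V" "v \<in> ?V" for u v
    using that by (intro square_integrable_mult sq)
  have inner: "future_inner M X \<Lambda> u v = (LINT s|?m. L u s * L v s)" if "u \<in> ?V" "v \<in> ?V" for u v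
    using that by (simp add: future_inner_def future_embedding_eq L2_inner_class sq)
  note add = subspace_add[OF subspace_future_space] and scale = subspace_scale[OF subspace_future_space]
  have "inner_product_on ?V (future_inner M X \<Lambda>)"
    unfolding inner_product_on_def
  proof (intro conjI ballI allI impI)
    show "subspace ?V" by (rule subspace_future_space)
  next
    fix u v assume "u \<in> ?V" "v \<in> ?V"
    then show "future_inner M X \<Lambda> u v = future_inner M X \<Lambda> v u"
      by (simp add: inner mult.commute)
  next
    fix u v w assume "u \<in> ?V" "v \<in> ?V" "w \<in> ?V"
    then show "future_inner M X \<Lambda> (u + v) w = future_inner M X \<Lambda> u w + future_inner M X \<Lambda> v w"
      by (simp add: inner add linear_add[OF lin] distrib_right int)
  next
    fix c u v assume "u \<in> ?V" "v \<in> ?V"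
    then show "future_inner M X \<Lambda> (c *\<^sub>R u) v = c * future_inner M X \<Lambda> u v"
      by (simp add: inner scale linear_scale[OF lin] scaleR_fun_apply mult.assoc)
  next
    fix u assume u: "u \<in> ?V"
    then show "0 \<le> future_inner M X \<Lambda> u u"
      by (simp add: inner)
    assume "future_inner M X \<Lambda> u u = 0"
    then have "AE s in ?m. L u s * L u s = 0"
      using integral_nonneg_eq_0_iff_AE[OF int[OF u u]] by (simp add: inner u)
    then have AE0: "AE s in ?m. L u s = 0" by simp
    have "u b = 0" for b
    proof -
      note [measurable] = square_integrableD(1)[OF sq[OF u]]
      have "u b = (LINT s|?m. L u s * indicator (cylinder b) s)"
        by (rule integral_extension_cylinder[OF u, symmetric])
      also have "\<dots> = (LINT s|?m. 0)"
        using AE0 by (intro integral_cong_AE) (auto elim: eventually_mono)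
      finally show ?thesis by simp
    qed
    then show "u = 0" by (simp add: fun_eq_iff)
  qed
  moreover have "has_bochner_integral ?m
        (\<lambda>s. (\<Sum>a | a \<in> \<Lambda> \<and> \<alpha> a \<noteq> 0. \<alpha> a * future_density M X (future_dist M X a) s) *
             (\<Sum>b | b \<in> \<Lambda> \<and> \<beta> b \<noteq> 0. \<beta> b * future_density M X (future_dist M X b) s))
        (future_inner M X \<Lambda>
          (\<Sum>a | a \<in> \<Lambda> \<and> \<alpha> a \<noteq> 0. \<alpha> a *\<^sub>R future_dist M X a)
          (\<Sum>b | b \<in> \<Lambda> \<and> \<beta> b \<noteq> 0. \<beta> b *\<^sub>R future_dist M X b))" for \<alpha> \<beta>
  proof -
    define comb where
      "comb \<alpha> = (\<Sum>a | a \<in> \<Lambda> \<and> \<alpha> a \<noteq> 0. \<alpha> a *\<^sub>R future_dist M X a)" for \<alpha> :: "'o list \<Rightarrow> real"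
    have comb: "comb \<alpha> \<in> ?V" for \<alpha>
      unfolding comb_def
      by (intro subspace_sum[OF subspace_future_space] scale future_dist_in_space)
    have "L (comb \<alpha>) s = (\<Sum>a | a \<in> \<Lambda> \<and> \<alpha> a \<noteq> 0. \<alpha> a * future_density M X (future_dist M X a) s)"
      for \<alpha> s
      by (simp add: comb_def linear_sum[OF lin] linear_scale[OF lin] L sum_fun_apply scaleR_fun_apply)
    with has_bochner_integral_integrable[OF int[OF comb[of \<alpha>] comb[of \<beta>]]]
    show ?thesis
      by (simp add: inner[OF comb comb] flip: comb_def)
  qed
  ultimately show ?thesis by blast
qed

end
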